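(* Let $\ell_1, \ell_2 \subset \mathbb{R}^{2n}$ be Lagrangian subspaces with respective frames $\mathbf{X}_1 = \binom{X_1}{Y_1}$ and $\mathbf{X}_2 = \binom{X_2}{Y_2}$, and let $\tilde{W}$ be the complex $n\times n$ matrix $$\tilde{W} = - (X_1 + i Y_1) (X_1 - i Y_1)^{-1} (X_2 - i Y_2) (X_2 + i Y_2)^{-1}.$$ Then $$\dim \ker (\tilde{W} + I) = \dim (\ell_1 \cap \ell_2),$$ where the left-hand side is the complex dimension of the kernel of $\tilde W + I$ acting on $\mathbb{C}^n$ and the right-hand side is the real dimension. That is, the dimension of the eigenspace of $\tilde{W}$ associated with the eigenvalue $-1$ is precisely the dimension of the intersection of $\ell_1$ and $\ell_2$.
   Context: Let $J = \begin{pmatrix} 0 & -I_n \\ I_n & 0 \end{pmatrix}$. A Lagrangian subspace of $\mathbb{R}^{2n}$ is a linear subspace $\ell$ of dimension $n$ such that $(Jx,y)_{\mathbb{R}^{2n}} = 0$ for all $x,y\in\ell$, where $(\cdot,\cdot)_{\mathbb{R}^{2n}}$ is the Euclidean inner product. A frame for $\ell$ is a real $2n\times n$ matrix $\mathbf{X} = \binom{X}{Y}$ (with $X,Y$ real $n\times n$ blocks) whose columns form a basis of $\ell$. For any frame of a Lagrangian subspace the matrices $X \pm iY$ are invertible, so $\tilde W$ is well defined. *)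

theory Defs
  imports "HOL-Analysis.Analysis"
begin

text \<open>
  The index type \<open>'n + 'n\<close> of the Euclidean space of dimension 2n splits a vector into its first n
  coordinates (indices \<open>Inl i\<close>) and its last n coordinates (indices \<open>Inr i\<close>), where n = \<open>CARD('n)\<close>.
\<close>

definition J_mat :: "real ^ ('n::finite + 'n) ^ ('n + 'n)" where
  "J_mat = (\<chi> r c. case (r, c) of
      (Inl i, Inr j) \<Rightarrow> (- mat 1 :: real ^ 'n ^ 'n) $ i $ j
    | (Inr i, Inl j) \<Rightarrow> (mat 1 :: real ^ 'n ^ 'n) $ i $ j
    | _ \<Rightarrow> 0)"

definition lagrangian_subspace :: "(real ^ ('n::finite + 'n)) set \<Rightarrow> bool" where
  "lagrangian_subspace L \<longleftrightarrow>
     subspace L \<and> dim L = CARD('n) \<and> (\<forall>x\<in>L. \<forall>y\<in>L. (J_mat *v x) \<bullet> y = 0)"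

text \<open>
  Injectivity is required because \<open>columns F\<close> is a set, which would hide repeated columns.
\<close>

definition is_frame :: "real ^ 'n ^ ('n::finite + 'n) \<Rightarrow> (real ^ ('n + 'n)) set \<Rightarrow> bool" where
  "is_frame F L \<longleftrightarrow>
     inj (\<lambda>j. column j F) \<and> independent (columns F) \<and> span (columns F) = L"

definition stack_blocks ::
    "real ^ 'n ^ 'n \<Rightarrow> real ^ 'n ^ 'n \<Rightarrow> real ^ 'n ^ ('n::finite + 'n)" where
  "stack_blocks X Y = (\<chi> r. case r of Inl i \<Rightarrow> X $ i | Inr i \<Rightarrow> Y $ i)"

definition cmat_plus :: "real ^ 'n ^ 'n \<Rightarrow> real ^ 'n ^ 'n \<Rightarrow> complex ^ 'n ^ 'n::finite" where
  "cmat_plus X Y = (\<chi> i j. complex_of_real (X $ i $ j) + \<i> * complex_of_real (Y $ i $ j))"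

definition cmat_minus :: "real ^ 'n ^ 'n \<Rightarrow> real ^ 'n ^ 'n \<Rightarrow> complex ^ 'n ^ 'n::finite" where
  "cmat_minus X Y = (\<chi> i j. complex_of_real (X $ i $ j) - \<i> * complex_of_real (Y $ i $ j))"

definition W_tilde ::
    "real ^ 'n ^ 'n \<Rightarrow> real ^ 'n ^ 'n \<Rightarrow> real ^ 'n ^ 'n \<Rightarrow> real ^ 'n ^ 'n
      \<Rightarrow> complex ^ 'n ^ 'n::finite" where
  "W_tilde X1 Y1 X2 Y2 =
     - (cmat_plus X1 Y1 ** matrix_inv (cmat_minus X1 Y1)
        ** cmat_minus X2 Y2 ** matrix_inv (cmat_plus X2 Y2))"

end

theory Submission
  imports Defs
begin

text \<open>
  Identify \<open>\<real>\<^sup>2\<^sup>n\<close> with \<open>\<complex>\<^sup>n\<close> by \<open>\<Phi>(a, b) = a + i b\<close>, so that \<open>J\<close> becomes multiplication by \<open>i\<close>.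
  On an isotropic subspace \<open>L\<close> the equation \<open>\<Phi> p + i \<Phi> q = 0\<close> says \<open>p = - J q\<close>, hence
  \<open>\<bar>p\<bar>\<^sup>2 = - (J q, p) = 0\<close>; thus \<open>L\<close> and \<open>i L\<close> are transversal in \<open>\<complex>\<^sup>n\<close>, and the complex span of
  \<open>\<Phi> L\<close> is a complexification of \<open>L\<close>. For a Lagrangian frame this makes \<open>X \<plusminus> i Y\<close> invertible.
  Substituting \<open>v = (X\<^sub>2 + i Y\<^sub>2) w\<close> and \<open>u = (X\<^sub>1 - i Y\<^sub>1)\<^sup>-\<^sup>1 (X\<^sub>2 - i Y\<^sub>2) w\<close>, the equation
  \<open>W v = - v\<close> becomes \<open>(X\<^sub>1 \<plusminus> i Y\<^sub>1) u = (X\<^sub>2 \<plusminus> i Y\<^sub>2) w\<close>, i.e. the frames map \<open>u\<close> and \<open>w\<close> to the same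
  vector of the complexification of \<open>\<real>\<^sup>2\<^sup>n\<close>. Hence the kernel is the complex span of
  \<open>\<Phi> (l1 \<inter> l2)\<close>.
\<close>

section \<open>Complex coordinates on the real symplectic space\<close>

definition cvec :: "real ^ 'n \<Rightarrow> real ^ 'n \<Rightarrow> complex ^ 'n" where
  "cvec s t = (\<chi> i. Complex (s $ i) (t $ i))"

text \<open>The real-linear identification \<Phi>.\<close>

definition fold_vec :: "real ^ ('n::finite + 'n) \<Rightarrow> complex ^ 'n" where
  "fold_vec p = (\<chi> i. Complex (p $ Inl i) (p $ Inr i))"

definition cnj_vec :: "complex ^ 'n \<Rightarrow> complex ^ 'n" where
  "cnj_vec v = (\<chi> i. cnj (v $ i))"

lemma cvec_cases:
  obtains s t where "w = cvec s t"
proof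
  show "w = cvec (\<chi> i. Re (w $ i)) (\<chi> i. Im (w $ i))"
    by (simp add: cvec_def vec_eq_iff)
qed

lemma cvec_eq_0_iff: "cvec s t = 0 \<longleftrightarrow> s = 0 \<and> t = 0"
  by (auto simp: cvec_def vec_eq_iff complex_eq_iff)

lemma cnj_vec_eq_0_iff: "cnj_vec v = 0 \<longleftrightarrow> v = 0"
  by (simp add: cnj_vec_def vec_eq_iff)

lemma linear_fold_vec: "linear fold_vec"
  by (rule linearI) (simp_all add: fold_vec_def vec_eq_iff complex_eq_iff)

lemma fold_vec_eq_0_iff: "fold_vec p = 0 \<longleftrightarrow> p = 0"
proof
  assume "fold_vec p = 0"
  then have "p $ Inl i = 0" "p $ Inr i = 0" for i
    by (simp_all add: fold_vec_def vec_eq_iff complex_eq_iff)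
  then have "p $ k = 0" for k
    by (cases k) simp_all
  then show "p = 0"
    by (simp add: vec_eq_iff)
qed (simp add: linear_0[OF linear_fold_vec])

lemma J_mat_mult_nth [simp]:
  "(J_mat *v p) $ Inl i = - p $ Inr i"
  "(J_mat *v p) $ Inr i = p $ Inl i"
  by (simp_all add: matrix_vector_mult_def J_mat_def UNIV_Plus_UNIV[symmetric] sum.Plus mat_def
        if_distrib[where f = "\<lambda>x. x * _"] if_distrib[where f = uminus] sum_negf cong: if_cong
        del: UNIV_Plus_UNIV)

lemma fold_vec_J_mat: "fold_vec (J_mat *v p) = \<i> *s fold_vec p"
  by (simp add: fold_vec_def vec_eq_iff complex_eq_iff)

lemma isotropic_fold_vec_eq_0:
  assumes iso: "\<And>x y. x \<in> L \<Longrightarrow> y \<in> L \<Longrightarrow> (J_mat *v x) \<bullet> y = 0"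
    and "p \<in> L" "q \<in> L" and eq: "fold_vec p + \<i> *s fold_vec q = 0"
  shows "p = 0 \<and> q = 0"
proof -
  have "fold_vec (p + J_mat *v q) = 0"
    using eq by (simp add: linear_add[OF linear_fold_vec] fold_vec_J_mat)
  then have p: "p = - (J_mat *v q)"
    by (simp add: fold_vec_eq_0_iff eq_neg_iff_add_eq_0)
  then have "p \<bullet> p = 0"
    using iso[OF \<open>q \<in> L\<close> \<open>p \<in> L\<close>] by (metis inner_minus_left neg_equal_0_iff_equal)
  then have "p = 0" by simp
  with eq show ?thesis
    by (auto simp: fold_vec_eq_0_iff linear_0[OF linear_fold_vec] vector_mul_eq_0)
qed

text \<open>Splitting coefficients into real and imaginary parts turns independence and spanning
  over the complex numbers into questions about real combinations in \<open>L\<close>.\<close>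

lemma sum_scale_fold_vec:
  "(\<Sum>b\<in>B. c b *s fold_vec b) =
     fold_vec (\<Sum>b\<in>B. Re (c b) *\<^sub>R b) + \<i> *s fold_vec (\<Sum>b\<in>B. Im (c b) *\<^sub>R b)"
  by (simp add: fold_vec_def vec_eq_iff complex_eq_iff sum.distrib sum_subtractf algebra_simps)

text \<open>A real basis of \<open>L\<close> is carried to a complex basis of the complex span. Only
  isotropy is assumed, because the lemma is meant for \<open>l1 \<inter> l2\<close>, which may have
  dimension below n.\<close>

lemma dim_fold_vec_isotropic:
  fixes L :: "(real ^ ('n::finite + 'n)) set"
  assumes L: "subspace L" and iso: "\<And>x y. x \<in> L \<Longrightarrow> y \<in> L \<Longrightarrow> (J_mat *v x) \<bullet> y = 0"
  shows "vec.dim {fold_vec p + \<i> *s fold_vec q | p q. p \<in> L \<and> q \<in> L} = dim L"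
    (is "vec.dim ?C = _")
proof -
  obtain B where B: "B \<subseteq> L" "independent B" "L \<subseteq> span B" "card B = dim L"
    using basis_exists by blast
  have fin: "finite B"
    using B(2) independent_imp_finite by blast
  have spanB: "span B = L"
    using B(1,3) L by (simp add: span_minimal subset_antisym)
  have sumL: "(\<Sum>b\<in>B. r b *\<^sub>R b) \<in> L" for r
    using B(1) L by (auto intro: subspace_sum subspace_scale)
  have inj: "inj_on fold_vec B"
    by (metis (no_types) fold_vec_eq_0_iff inj_onI linear_diff[OF linear_fold_vec]
        right_minus_eq)
  have indep: "vec.independent (fold_vec ` B)"
  proof (rule vec.independent_if_scalars_zero)
    fix c x
    assume "(\<Sum>x\<in>fold_vec ` B. c x *s x) = 0" and x: "x \<in> fold_vec ` B"
    then have "(\<Sum>b\<in>B. c (fold_vec b) *s fold_vec b) = 0"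
      by (simp add: sum.reindex[OF inj])
    \<comment> \<open>Isotropy makes the real and imaginary combinations vanish separately.\<close>
    then have eqs: "(\<Sum>b\<in>B. Re (c (fold_vec b)) *\<^sub>R b) = 0" "(\<Sum>b\<in>B. Im (c (fold_vec b)) *\<^sub>R b) = 0"
      using isotropic_fold_vec_eq_0[OF iso sumL sumL] by (simp_all add: sum_scale_fold_vec)
    from x obtain b where "b \<in> B" "x = fold_vec b" by blast
    then show "c x = 0"
      using independentD[OF B(2) fin subset_refl eqs(1)]
        independentD[OF B(2) fin subset_refl eqs(2)]
      by (simp add: complex_eq_iff)
  qed (use fin in simp)
  have "?C = vec.span (fold_vec ` B)"
  proof
    show "?C \<subseteq> vec.span (fold_vec ` B)"
    proof clarify
      fix p q assume "p \<in> L" "q \<in> L"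
      then obtain r s where "p = (\<Sum>b\<in>B. r b *\<^sub>R b)" "q = (\<Sum>b\<in>B. s b *\<^sub>R b)"
        using spanB by (auto simp: span_finite[OF fin])
      then have "fold_vec p + \<i> *s fold_vec q = (\<Sum>b\<in>B. Complex (r b) (s b) *s fold_vec b)"
        by (simp add: sum_scale_fold_vec)
      then show "fold_vec p + \<i> *s fold_vec q \<in> vec.span (fold_vec ` B)"
        by (auto intro: vec.span_sum vec.span_scale vec.span_base)
    qed
    show "vec.span (fold_vec ` B) \<subseteq> ?C"
    proof
      fix v assume "v \<in> vec.span (fold_vec ` B)"
      then obtain c where "v = (\<Sum>x\<in>fold_vec ` B. c x *s x)"
        using fin by (auto simp: vec.span_finite)
      then have "v = (\<Sum>b\<in>B. c (fold_vec b) *s fold_vec b)"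
        by (simp add: sum.reindex[OF inj])
      then show "v \<in> ?C"
        by (auto simp: sum_scale_fold_vec intro!: exI sumL)
    qed
  qed
  then have "vec.dim ?C = card (fold_vec ` B)"
    using indep by (metis vec.dim_span_eq_card_independent)
  also have "\<dots> = dim L"
    using B(4) inj by (simp add: card_image)
  finally show ?thesis .
qed

section \<open>Frames and invertibility\<close>

lemma cmat_plus_mult_cvec:
  "cmat_plus X Y *v cvec s t =
     fold_vec (stack_blocks X Y *v s) + \<i> *s fold_vec (stack_blocks X Y *v t)"
  by (simp add: cmat_plus_def cvec_def fold_vec_def stack_blocks_def matrix_vector_mult_def
      vec_eq_iff complex_eq_iff sum.distrib sum_subtractf sum_negf algebra_simps)

text \<open>\<open>cmat_minus X Y\<close> is the entrywise conjugate of
  \<open>cmat_plus X Y\<close>, so it acts by conjugating the vector, applying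
  \<open>cmat_plus X Y\<close> and conjugating back; hence the sign before the second term.\<close>

lemma cmat_minus_mult_cvec:
  "cmat_minus X Y *v cvec s t =
     cnj_vec (fold_vec (stack_blocks X Y *v s) - \<i> *s fold_vec (stack_blocks X Y *v t))"
  by (simp add: cmat_minus_def cvec_def fold_vec_def stack_blocks_def matrix_vector_mult_def
      cnj_vec_def vec_eq_iff complex_eq_iff sum.distrib sum_subtractf sum_negf algebra_simps)

lemma frame_range: "is_frame F L \<Longrightarrow> range ((*v) F) = L"
proof -
  assume "is_frame F L"
  \<comment> \<open>The columns of \<open>F\<close> are the images of the standard basis, so their
    span is the range.\<close>
  moreover have "range (\<lambda>i. axis i (1::real)) = Basis"
    by (auto simp: Basis_vec_def)
  ultimately show ?thesis
    by (metis (no_types) columns_image_basis is_frame_def matrix_vector_mul_linear span_Basis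
        span_linear_image)
qed

text \<open>The column rank is \<open>dim L\<close>, which equals the number of columns.\<close>

lemma frame_inj:
  fixes F :: "real ^ 'n ^ ('n::finite + 'n)"
  assumes "lagrangian_subspace L" "is_frame F L"
  shows "inj ((*v) F)"
  using assms
  by (metis column_rank_def dim_span full_rank_injective is_frame_def lagrangian_subspace_def)

lemma frame_cmat_mult_eq_0:
  assumes lag: "lagrangian_subspace L" and fr: "is_frame (stack_blocks X Y) L"
  shows "cmat_plus X Y *v w = 0 \<Longrightarrow> w = 0" and "cmat_minus X Y *v w = 0 \<Longrightarrow> w = 0"
proof -
  let ?F = "stack_blocks X Y"
  obtain s t where w: "w = cvec s t" by (rule cvec_cases)
  have iso: "\<And>x y. x \<in> L \<Longrightarrow> y \<in> L \<Longrightarrow> (J_mat *v x) \<bullet> y = 0"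
    using lag by (simp add: lagrangian_subspace_def)
  have in_L: "?F *v x \<in> L" for x
    using frame_range[OF fr] by blast
  have inj0: "x = 0" if "?F *v x = 0" for x
    using frame_inj[OF lag fr] that by (metis injD matrix_vector_mult_0_right)
  show "w = 0" if "cmat_plus X Y *v w = 0"
    using isotropic_fold_vec_eq_0[OF iso in_L in_L, of s t] that inj0
    by (simp add: w cmat_plus_mult_cvec cvec_eq_0_iff)
  \<comment> \<open>Replacing \<open>t\<close> by \<open>- t\<close> reduces the conjugate matrix to
    the isotropy argument, since \<open>?F *v (- t)\<close> also lies in \<open>L\<close>.\<close>
  have "fold_vec (?F *v s) + \<i> *s fold_vec (?F *v (- t)) = 0" if "cmat_minus X Y *v w = 0"
    using that
    by (simp add: w cmat_minus_mult_cvec cnj_vec_eq_0_iff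
        linear_neg[OF matrix_vector_mul_linear] linear_neg[OF linear_fold_vec])
  then show "w = 0" if "cmat_minus X Y *v w = 0"
    using isotropic_fold_vec_eq_0[OF iso in_L in_L, of s "- t"] that inj0[of s] inj0[of "- t"]
    by (simp add: w cvec_eq_0_iff)
qed

lemma matrix_inv_of_ker_0:
  fixes A :: "'a::field ^ 'n ^ 'n"
  assumes "\<And>x. A *v x = 0 \<Longrightarrow> x = 0"
  shows "A ** matrix_inv A = mat 1" "matrix_inv A ** A = mat 1"
proof -
  have "invertible A"
    using assms by (metis invertible_left_inverse matrix_left_invertible_ker)
  then have "A ** matrix_inv A = mat 1 \<and> matrix_inv A ** A = mat 1"
    unfolding invertible_def matrix_inv_def by (rule someI_ex)
  then show "A ** matrix_inv A = mat 1" "matrix_inv A ** A = mat 1"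
    by simp_all
qed

text \<open>Write p + iq = (A, B) with complex blocks. The two sides compared are A + iB and A - iB;
  neither alone determines (A, B), but together they do.\<close>

lemma fold_vec_pair_eq_iff:
  "fold_vec p + \<i> *s fold_vec q = fold_vec p' + \<i> *s fold_vec q' \<and>
   cnj_vec (fold_vec p - \<i> *s fold_vec q) = cnj_vec (fold_vec p' - \<i> *s fold_vec q') \<longleftrightarrow>
   p = p' \<and> q = q'" (is "?L \<longleftrightarrow> ?R")
proof
  assume eq: ?L
  have "p $ Inl i = p' $ Inl i \<and> p $ Inr i = p' $ Inr i \<and>
    q $ Inl i = q' $ Inl i \<and> q $ Inr i = q' $ Inr i" for i
  proof -
    have "(fold_vec p + \<i> *s fold_vec q) $ i = (fold_vec p' + \<i> *s fold_vec q') $ i"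
      "cnj_vec (fold_vec p - \<i> *s fold_vec q) $ i = cnj_vec (fold_vec p' - \<i> *s fold_vec q') $ i"
      using eq by simp_all
    then show ?thesis
      by (simp add: fold_vec_def cnj_vec_def complex_eq_iff)
  qed
  then have "p $ k = p' $ k \<and> q $ k = q' $ k" for k
    by (cases k) simp_all
  then show ?R
    by (simp add: vec_eq_iff)
qed simp

section \<open>The kernel as a complexified intersection\<close>

lemma ker_W_tilde_plus_1:
  assumes lag1: "lagrangian_subspace l1" and lag2: "lagrangian_subspace l2"
    and fr1: "is_frame (stack_blocks X1 Y1) l1" and fr2: "is_frame (stack_blocks X2 Y2) l2"
  shows "{v. (W_tilde X1 Y1 X2 Y2 + mat 1) *v v = 0} =
    {fold_vec p + \<i> *s fold_vec q | p q. p \<in> l1 \<inter> l2 \<and> q \<in> l1 \<inter> l2}" (is "?K = ?C")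
proof -
  let ?F1 = "stack_blocks X1 Y1" and ?F2 = "stack_blocks X2 Y2"
  let ?Z1 = "cmat_plus X1 Y1" and ?Z2 = "cmat_plus X2 Y2"
  let ?V1 = "cmat_minus X1 Y1" and ?V2 = "cmat_minus X2 Y2"
  have inv1: "?V1 *v (matrix_inv ?V1 *v x) = x" "matrix_inv ?V1 *v (?V1 *v x) = x" for x
    using matrix_inv_of_ker_0[OF frame_cmat_mult_eq_0(2)[OF lag1 fr1]]
    by (simp_all add: matrix_vector_mul_assoc)
  have inv2: "?Z2 *v (matrix_inv ?Z2 *v x) = x" "matrix_inv ?Z2 *v (?Z2 *v x) = x" for x
    using matrix_inv_of_ker_0[OF frame_cmat_mult_eq_0(1)[OF lag2 fr2]]
    by (simp_all add: matrix_vector_mul_assoc)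
  \<comment> \<open>Reading W + I as I - (-W) absorbs the sign in \<open>W_tilde\<close>: the kernel
    consists of the fixed points of the unsigned product.\<close>
  have W: "v \<in> ?K \<longleftrightarrow> ?Z1 *v (matrix_inv ?V1 *v (?V2 *v (matrix_inv ?Z2 *v v))) = v" for v
    using matrix_vector_mult_diff_rdistrib[of "mat 1" "- W_tilde X1 Y1 X2 Y2" v]
    by (auto simp: W_tilde_def matrix_vector_mul_assoc matrix_mul_assoc add.commute)
  have K: "v \<in> ?K \<longleftrightarrow> (\<exists>u w. ?Z1 *v u = v \<and> ?Z2 *v w = v \<and> ?V1 *v u = ?V2 *v w)" for v
  proof
    assume "v \<in> ?K"
    then show "\<exists>u w. ?Z1 *v u = v \<and> ?Z2 *v w = v \<and> ?V1 *v u = ?V2 *v w"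
      unfolding W using inv1(1) inv2(1) by blast
  next
    assume "\<exists>u w. ?Z1 *v u = v \<and> ?Z2 *v w = v \<and> ?V1 *v u = ?V2 *v w"
    then show "v \<in> ?K"
      unfolding W using inv1(2) inv2(2) by metis
  qed
  show ?thesis
  proof (intro set_eqI iffI)
    fix v assume "v \<in> ?K"
    then obtain u w where uw: "?Z1 *v u = v" "?Z2 *v w = v" "?V1 *v u = ?V2 *v w"
      unfolding K by blast
    obtain s t s' t' where "u = cvec s t" "w = cvec s' t'"
      by (metis cvec_cases)
    \<comment> \<open>The two expressions for \<open>v\<close> give the unconjugated equality of the
      pair lemma, and the equation between \<open>?V1\<close> and \<open>?V2\<close> gives the
      conjugated one.\<close>
    with uw have "?F1 *v s = ?F2 *v s' \<and> ?F1 *v t = ?F2 *v t'"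
      and v: "v = fold_vec (?F1 *v s) + \<i> *s fold_vec (?F1 *v t)"
      by (simp_all add: cmat_plus_mult_cvec cmat_minus_mult_cvec flip: fold_vec_pair_eq_iff)
    then have "?F1 *v s \<in> l1 \<inter> l2" "?F1 *v t \<in> l1 \<inter> l2"
      using frame_range[OF fr1] frame_range[OF fr2] by (metis IntI rangeI)+
    with v show "v \<in> ?C" by blast
  next
    fix v assume "v \<in> ?C"
    then obtain p q where v: "v = fold_vec p + \<i> *s fold_vec q"
      and pq: "p \<in> l1 \<inter> l2" "q \<in> l1 \<inter> l2" by blast
    from pq obtain s t s' t' where "?F1 *v s = p" "?F1 *v t = q" "?F2 *v s' = p" "?F2 *v t' = q"
      using frame_range[OF fr1] frame_range[OF fr2] by (metis IntE imageE)
    then have "?Z1 *v cvec s t = v \<and> ?Z2 *v cvec s' t' = v \<and> ?V1 *v cvec s t = ?V2 *v cvec s' t'"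
      by (simp add: v cmat_plus_mult_cvec cmat_minus_mult_cvec)
    then show "v \<in> ?K"
      unfolding K by blast
  qed
qed

theorem theorem1p3:
  fixes l1 l2 :: "(real ^ ('n::finite + 'n)) set"
    and X1 Y1 X2 Y2 :: "real ^ 'n ^ 'n"
  assumes "lagrangian_subspace l1"
    and "lagrangian_subspace l2"
    and "is_frame (stack_blocks X1 Y1) l1"
    and "is_frame (stack_blocks X2 Y2) l2"
  shows "vec.dim {v :: complex ^ 'n. (W_tilde X1 Y1 X2 Y2 + mat 1) *v v = 0} = dim (l1 \<inter> l2)"
proof -
  have "subspace (l1 \<inter> l2)"
    using assms(1,2) by (simp add: lagrangian_subspace_def subspace_inter)
  moreover have "(J_mat *v x) \<bullet> y = 0" if "x \<in> l1 \<inter> l2" "y \<in> l1 \<inter> l2" for x y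
    using assms(1) that by (simp add: lagrangian_subspace_def)
  ultimately show ?thesis
    unfolding ker_W_tilde_plus_1[OF assms] by (rule dim_fold_vec_isotropic)
qed

end
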